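(* Let $Y$ be a reflexive asymptotically uniformly smooth Banach space, and assume that a Banach space $X$ coarse Lipschitz embeds into $Y$. Then $X$ has the Banach-Saks property.
   Context: All Banach spaces are real and infinite dimensional. For a map $f:(M,d)\to(N,\partial)$ between metric spaces, $\omega_f(t)=\sup\{\partial(f(x),f(y)) : d(x,y)\le t\}$ and $\rho_f(t)=\inf\{\partial(f(x),f(y)) : d(x,y)\ge t\}$. $f$ is a coarse Lipschitz embedding if there is $L>0$ with $\omega_f(t)\le Lt+L$ and $\rho_f(t)\ge L^{-1}t-L$ for all $t\ge 0$. The modulus of asymptotic uniform smoothness of a Banach space $Y$ is $\overline{\rho}_Y(t)=\sup_{x\in\partial B_Y}\inf_{\dim(Y/E)<\infty}\sup_{h\in\partial B_E}\|x+th\|-1$, where $E$ ranges over closed finite-codimensional subspaces and $\partial B$ denotes the unit sphere; $Y$ is asymptotically uniformly smooth if $\lim_{t\to0^+}\overline{\rho}_Y(t)/t=0$. A Banach space $X$ has the Banach-Saks property if every bounded sequence $(x_n)$ in $X$ has a subsequence $(x_{n_j})$ such that $(\frac1k\sum_{j=1}^k x_{n_j})_{k}$ converges in norm. *)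

theory Defs
  imports "HOL-Analysis.Analysis"
begin

definition infinite_dimensional :: "'a::real_normed_vector itself \<Rightarrow> bool" where
  "infinite_dimensional _ \<longleftrightarrow> \<not> (\<exists>B::'a set. finite B \<and> span B = UNIV)"

definition reflexive_space :: "'a::real_normed_vector itself \<Rightarrow> bool" where
  "reflexive_space _ \<longleftrightarrow>
     (\<forall>\<phi> :: ('a \<Rightarrow>\<^sub>L real) \<Rightarrow>\<^sub>L real. \<exists>x::'a. \<forall>f. blinfun_apply \<phi> f = blinfun_apply f x)"

definition fin_codim_subspaces :: "'a::real_normed_vector set set" where
  "fin_codim_subspaces = {E. subspace E \<and> closed E \<and>
       (\<exists>F. finite F \<and> (\<forall>y. \<exists>e\<in>E. y - e \<in> span F))}"

definition aus_modulus :: "'a::real_normed_vector itself \<Rightarrow> real \<Rightarrow> real" where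
  "aus_modulus _ t =
     (SUP x\<in>(sphere (0::'a) 1).
        (INF E\<in>(fin_codim_subspaces::'a set set).
           (SUP h\<in>(E \<inter> sphere 0 1). norm (x + t *\<^sub>R h) - 1)))"

definition asymptotically_uniformly_smooth :: "'a::real_normed_vector itself \<Rightarrow> bool" where
  "asymptotically_uniformly_smooth T \<longleftrightarrow>
     ((\<lambda>t. aus_modulus T t / t) \<longlongrightarrow> 0) (at_right 0)"

text \<open>Coarse Lipschitz embedding: omega_f(t) <= L t + L and rho_f(t) >= t/L - L for all t >= 0,
  written out pointwise.\<close>
definition coarse_lipschitz_embedding :: "('a::metric_space \<Rightarrow> 'b::metric_space) \<Rightarrow> bool" where
  "coarse_lipschitz_embedding f \<longleftrightarrow>
     (\<exists>L>0. \<forall>x y. dist (f x) (f y) \<le> L * dist x y + L \<and>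
                  dist (f x) (f y) \<ge> dist x y / L - L)"

definition banach_saks :: "'a::real_normed_vector itself \<Rightarrow> bool" where
  "banach_saks _ \<longleftrightarrow>
     (\<forall>x::nat \<Rightarrow> 'a. bounded (range x) \<longrightarrow>
        (\<exists>r. strict_mono r \<and>
             convergent (\<lambda>k. (1 / real k) *\<^sub>R (\<Sum>j\<in>{1..k}. x (r j)))))"

end

theory Submission
  imports Defs
begin

text \<open>
  Let \<open>x\<close> be a bounded sequence in \<open>X\<close> and \<open>f\<close> a coarse Lipschitz embedding into \<open>Y\<close>. On \<open>k\<close>-tuples of
  indices put \<open>F(n\<^sub>1,\<dots>,n\<^sub>k) = f(x(n\<^sub>1) + \<dots> + x(n\<^sub>k))\<close>; it is Lipschitz for the Hamming distance,
  with a constant independent of \<open>k\<close>. By reflexivity the variables can be removed one at a time, last one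
  first, by weak limits along a free ultrafilter. Restoring a variable adds a bounded weakly null
  perturbation, and by asymptotic uniform smoothness this increases the distance to the total limit
  \<open>u\<close> by at most \<open>\<epsilon>\<close> once that distance is large. Hence, on tuples from a suitable subsequence, \<open>F\<close>
  stays within \<open>o(k)\<close> of \<open>u\<close> (Kalton and Randrianarivony), so any two sums of \<open>k\<close> consecutive terms of
  this subsequence of \<open>x\<close> differ by \<open>o(k)\<close>. Diagonalising over \<open>k\<close> makes the Cesaro means Cauchy.
\<close>

section \<open>Ultrafilters\<close>

definition ultrafilter :: "'a filter \<Rightarrow> bool" where
  "ultrafilter U \<longleftrightarrow> U \<noteq> bot \<and> (\<forall>P. eventually P U \<or> eventually (\<lambda>x. \<not> P x) U)"

text \<open>Zorn for the proper filters below \<open>F\<close>, ordered by refinement. A minimal one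
  decides every \<open>P\<close>: intersecting it with \<open>P\<close> either gives
  \<open>bot\<close> or, by minimality, changes nothing.\<close>

lemma ultrafilter_exists:
  fixes F :: "'a filter"
  assumes "F \<noteq> bot"
  obtains U where "ultrafilter U" "U \<le> F"
proof -
  let ?A = "{G. G \<noteq> bot \<and> G \<le> F}"
  have "\<exists>m\<in>?A. \<forall>a\<in>?A. a \<le> m \<longrightarrow> a = m"
  proof (rule predicate_Zorn)
    show "partial_order_on ?A (relation_of (\<lambda>x y. y \<le> x) ?A)"
      by (rule partial_order_on_relation_ofI) auto
  next
    fix C assume C: "C \<in> Chains (relation_of (\<lambda>x y. y \<le> x) ?A)"
    have CA: "C \<subseteq> ?A" and lin: "\<And>a b. a \<in> C \<Longrightarrow> b \<in> C \<Longrightarrow> a \<le> b \<or> b \<le> a"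
      using C unfolding Chains_def relation_of_def by blast+
    show "\<exists>u\<in>?A. \<forall>a\<in>C. u \<le> a"
    proof (cases "C = {}")
      case True
      then show ?thesis using assms by blast
    next
      case False
      \<comment> \<open>A nonempty chain is a filter base, so \<open>Inf C\<close> could be
        \<open>bot\<close> only if some member of \<open>C\<close> were.\<close>
      have "eventually P (Inf C) \<longleftrightarrow> (\<exists>b\<in>C. eventually P b)" for P
        using False
      proof (rule eventually_Inf_base)
        fix a b assume "a \<in> C" "b \<in> C"
        then show "\<exists>x\<in>C. x \<le> inf a b"
          using lin[of a b] by (metis inf.absorb1 inf.absorb2 order_refl)
      qed
      then have "Inf C \<noteq> bot"
        using CA unfolding trivial_limit_def by blast
      moreover have "Inf C \<le> F"
      proof -
        obtain G where "G \<in> C" using False by blast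
        with CA show ?thesis by (intro Inf_lower2[of G]) auto
      qed
      ultimately show ?thesis
        by (intro bexI[of _ "Inf C"] ballI Inf_lower) simp_all
    qed
  qed
  then obtain U where U: "U \<noteq> bot" "U \<le> F"
    and min: "\<And>G. G \<noteq> bot \<Longrightarrow> G \<le> F \<Longrightarrow> G \<le> U \<Longrightarrow> G = U"
    by blast
  have "eventually P U \<or> eventually (\<lambda>x. \<not> P x) U" for P
  proof (cases "inf U (principal {x. P x}) = bot")
    case True
    then have "eventually (\<lambda>x. \<not> P x) U"
      by (auto simp: trivial_limit_def eventually_inf_principal)
    then show ?thesis ..
  next
    case False
    then have "inf U (principal {x. P x}) = U"
      using U by (intro min) (auto intro: le_infI1)
    then have "U \<le> principal {x. P x}"
      by (metis inf_le2)
    then show ?thesis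
      by (simp add: le_principal)
  qed
  with U that show ?thesis
    unfolding ultrafilter_def by blast
qed

text \<open>Compactness gives a cluster point of the image filter. An ultrafilter that did not
  converge to it would eventually avoid one of its neighbourhoods.\<close>

lemma ultrafilter_compact_tendsto:
  fixes s :: "'a \<Rightarrow> 'b::topological_space"
  assumes "ultrafilter U" "compact K" "\<And>n. s n \<in> K"
  obtains l where "(s \<longlongrightarrow> l) U"
proof -
  have "filtermap s U \<noteq> bot"
    using assms(1) by (simp add: ultrafilter_def filtermap_bot_iff)
  moreover have "eventually (\<lambda>x. x \<in> K) (filtermap s U)"
    using assms(3) by (simp add: eventually_filtermap)
  ultimately obtain l where l: "inf (nhds l) (filtermap s U) \<noteq> bot"
    using assms(2) unfolding compact_filter by blast
  have "eventually (\<lambda>n. s n \<in> S) U" if "open S" "l \<in> S" for S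
  proof (rule ccontr)
    assume "\<not> ?thesis"
    then have "eventually (\<lambda>n. s n \<notin> S) U"
      using assms(1) unfolding ultrafilter_def by blast
    then have "eventually (\<lambda>x. x \<notin> S) (filtermap s U)"
      by (simp add: eventually_filtermap)
    moreover have "eventually (\<lambda>x. x \<in> S) (nhds l)"
      using that by (rule eventually_nhds_in_open)
    ultimately have "eventually (\<lambda>x. False) (inf (nhds l) (filtermap s U))"
      unfolding eventually_inf by blast
    then show False
      using l by (simp add: trivial_limit_def)
  qed
  then have "(s \<longlongrightarrow> l) U"
    by (rule topological_tendstoI)
  then show thesis by (rule that)
qed

section \<open>The Hahn-Banach theorem\<close>

definition sublinear :: "('a::real_vector \<Rightarrow> real) \<Rightarrow> bool" where
  "sublinear q \<longleftrightarrow> (\<forall>x y. q (x + y) \<le> q x + q y) \<and> (\<forall>c x. 0 \<le> c \<longrightarrow> q (c *\<^sub>R x) = c * q x)"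

lemma sublinearD:
  assumes "sublinear q"
  shows "q (x + y) \<le> q x + q y" "0 \<le> c \<Longrightarrow> q (c *\<^sub>R x) = c * q x"
  using assms unfolding sublinear_def by auto

lemma sublinear_zero: "sublinear q \<Longrightarrow> q 0 = 0"
  using sublinearD(2)[of q 0 0] by simp

lemma sublinear_minus: "sublinear q \<Longrightarrow> - q (- x) \<le> q x"
  using sublinearD(1)[of q x "- x"] sublinear_zero[of q] by simp

text \<open>Supplies lower bounds of chains for the Zorn argument below. Directedness puts one
  \<open>c\<close> under both \<open>a\<close> and \<open>b\<close>, so subadditivity of
  \<open>c\<close> bounds the infimum at \<open>x + y\<close> by \<open>a x + b y\<close>.\<close>

lemma sublinear_Inf:
  fixes Q :: "('a::real_vector \<Rightarrow> real) set"
  assumes ne: "Q \<noteq> {}" and sub: "\<And>q. q \<in> Q \<Longrightarrow> sublinear q"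
    and bdd: "\<And>x. bdd_below ((\<lambda>q. q x) ` Q)"
    and dir: "\<And>a b. a \<in> Q \<Longrightarrow> b \<in> Q \<Longrightarrow> \<exists>c\<in>Q. c \<le> a \<and> c \<le> b"
  shows "sublinear (\<lambda>x. INF q\<in>Q. q x)"
proof -
  let ?g = "\<lambda>x. INF q\<in>Q. q x"
  have low: "?g x \<le> q x" if "q \<in> Q" for q x
    using bdd that by (rule cINF_lower)
  have "?g (x + y) \<le> ?g x + ?g y" for x y
  proof -
    have *: "?g (x + y) \<le> a x + b y" if ab: "a \<in> Q" "b \<in> Q" for a b
    proof -
      obtain c where c: "c \<in> Q" "c \<le> a" "c \<le> b"
        using dir[OF ab] by blast
      have "?g (x + y) \<le> c x + c y"
        using low[OF c(1), of "x + y"] sublinearD(1)[OF sub[OF c(1)], of x y] by linarith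
      also have "\<dots> \<le> a x + b y"
        using c by (intro add_mono) (auto simp: le_fun_def)
      finally show ?thesis .
    qed
    have "?g (x + y) - b y \<le> ?g x" if "b \<in> Q" for b
      using ne by (rule cINF_greatest) (use *[OF _ that] in \<open>simp add: algebra_simps\<close>)
    then have "?g (x + y) - ?g x \<le> b y" if "b \<in> Q" for b
      using that by (simp add: algebra_simps)
    then have "?g (x + y) - ?g x \<le> ?g y"
      using ne by (intro cINF_greatest) auto
    then show ?thesis by simp
  qed
  moreover have "?g (c *\<^sub>R x) = c * ?g x" if "0 \<le> c" for c x
  proof -
    \<comment> \<open>The reverse inequality is this one applied to \<open>inverse c\<close> and
      \<open>c *\<^sub>R x\<close>.\<close>
    have le: "c * ?g x \<le> ?g (c *\<^sub>R x)" if "0 \<le> c" for c x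
      using ne
    proof (rule cINF_greatest)
      fix q assume "q \<in> Q"
      then show "c * ?g x \<le> q (c *\<^sub>R x)"
        using that low[of q x] sublinearD(2)[OF sub, of q c x] by (simp add: mult_left_mono)
    qed
    show ?thesis
    proof (cases "c = 0")
      case True
      have "(\<lambda>q. q 0) ` Q = {0}"
        using ne sublinear_zero[OF sub] by (force simp: image_iff)
      then show ?thesis using True by simp
    next
      case False
      with that have c: "0 < c" by simp
      have "inverse c * ?g (c *\<^sub>R x) \<le> ?g x"
        using le[of "inverse c" "c *\<^sub>R x"] c by simp
      then have "?g (c *\<^sub>R x) \<le> c * ?g x"
        using c by (simp add: field_simps)
      with le[OF that, of x] show ?thesis by simp
    qed
  qed
  ultimately show ?thesis
    unfolding sublinear_def by blast
qed

text \<open>A sublinear functional that cannot be lowered in any direction \<open>v\<close> is additive.\<close>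

definition lowering :: "('a::real_vector \<Rightarrow> real) \<Rightarrow> 'a \<Rightarrow> 'a \<Rightarrow> real" where
  "lowering q v x = (INF t\<in>{0..}. q (x + t *\<^sub>R v) - t * q v)"

lemma lowering_le:
  assumes "sublinear q" "0 \<le> t"
  shows "lowering q v x \<le> q (x + t *\<^sub>R v) - t * q v"
proof -
  \<comment> \<open>A lower bound independent of \<open>t\<close>, so that the infimum is over a set
    bounded below.\<close>
  have "- q (- x) \<le> q (x + t *\<^sub>R v) - t * q v" if "0 \<le> t" for t
    using sublinearD(1)[OF assms(1), of "x + t *\<^sub>R v" "- x"] sublinearD(2)[OF assms(1) that, of v]
    by simp
  then have "bdd_below ((\<lambda>t. q (x + t *\<^sub>R v) - t * q v) ` {0..})"
    by (intro bdd_belowI2[of _ "- q (- x)"]) auto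
  then show ?thesis
    unfolding lowering_def using assms(2) by (intro cINF_lower) auto
qed

text \<open>Parameters \<open>s\<close> for \<open>x\<close> and \<open>t\<close> for
  \<open>y\<close> add up to an admissible parameter \<open>s + t\<close> for \<open>x + y\<close>;
  scaling \<open>x\<close> by \<open>c > 0\<close> scales the parameter by \<open>c\<close>.\<close>

lemma sublinear_lowering:
  assumes q: "sublinear q"
  shows "sublinear (lowering q v)"
proof -
  let ?g = "lowering q v"
  have great: "a \<le> ?g x" if "\<And>t. 0 \<le> t \<Longrightarrow> a \<le> q (x + t *\<^sub>R v) - t * q v" for a x
    unfolding lowering_def using that by (intro cINF_greatest) auto
  have "?g (x + y) \<le> ?g x + ?g y" for x y
  proof -
    have *: "?g (x + y) \<le> (q (x + s *\<^sub>R v) - s * q v) + (q (y + t *\<^sub>R v) - t * q v)"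
      if "0 \<le> s" "0 \<le> t" for s t
      using lowering_le[OF q, of "s + t" v "x + y"] that
        sublinearD(1)[OF q, of "x + s *\<^sub>R v" "y + t *\<^sub>R v"]
      by (simp add: algebra_simps)
    have "?g (x + y) - (q (y + t *\<^sub>R v) - t * q v) \<le> ?g x" if "0 \<le> t" for t
      by (rule great) (use *[OF _ that] in \<open>simp add: algebra_simps\<close>)
    then have "?g (x + y) - ?g x \<le> ?g y"
      by (intro great) (simp add: algebra_simps)
    then show ?thesis by simp
  qed
  moreover have "?g (c *\<^sub>R x) = c * ?g x" if "0 \<le> c" for c x
  proof -
    have le: "?g (c *\<^sub>R x) \<le> c * ?g x" if c: "0 < c" for c x
    proof -
      have "?g (c *\<^sub>R x) / c \<le> ?g x"
      proof (rule great)
        fix t :: real assume t: "0 \<le> t"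
        have "?g (c *\<^sub>R x) \<le> q (c *\<^sub>R x + (c * t) *\<^sub>R v) - (c * t) * q v"
          using c t by (intro lowering_le[OF q]) simp
        also have "c *\<^sub>R x + (c * t) *\<^sub>R v = c *\<^sub>R (x + t *\<^sub>R v)"
          by (simp add: algebra_simps)
        also have "q \<dots> = c * q (x + t *\<^sub>R v)"
          using c by (intro sublinearD(2)[OF q]) simp
        finally show "?g (c *\<^sub>R x) / c \<le> q (x + t *\<^sub>R v) - t * q v"
          using c by (simp add: field_simps)
      qed
      then show ?thesis using c by (simp add: field_simps)
    qed
    show ?thesis
    proof (cases "c = 0")
      case True
      have "?g 0 \<le> 0"
        using lowering_le[OF q, of 0 v 0] sublinear_zero[OF q] by simp
      moreover have "0 \<le> ?g 0"
        by (rule great) (simp add: sublinearD(2)[OF q])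
      ultimately show ?thesis using True by simp
    next
      case False
      with that have c: "0 < c" by simp
      have "?g x \<le> inverse c * ?g (c *\<^sub>R x)"
        using le[of "inverse c" "c *\<^sub>R x"] c by simp
      then have "c * ?g x \<le> ?g (c *\<^sub>R x)"
        using c by (simp add: field_simps)
      with le[OF c, of x] show ?thesis by simp
    qed
  qed
  ultimately show ?thesis
    unfolding sublinear_def by blast
qed

text \<open>Zorn yields a minimal sublinear \<open>q\<close> below \<open>p\<close>. Minimality
  gives \<open>lowering q v = q\<close>, and the parameter \<open>t = 1\<close> turns this into
  superadditivity, so \<open>q\<close> is linear.\<close>

lemma sublinear_dominates_linear:
  fixes p :: "'a::real_vector \<Rightarrow> real"
  assumes p: "sublinear p"
  obtains f where "linear f" "\<And>x. f x \<le> p x"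
proof -
  let ?A = "{q. sublinear q \<and> q \<le> p}"
  have "\<exists>m\<in>?A. \<forall>a\<in>?A. a \<le> m \<longrightarrow> a = m"
  proof (rule predicate_Zorn)
    show "partial_order_on ?A (relation_of (\<lambda>x y. y \<le> x) ?A)"
      by (rule partial_order_on_relation_ofI) auto
  next
    fix C assume C: "C \<in> Chains (relation_of (\<lambda>x y. y \<le> x) ?A)"
    have CA: "C \<subseteq> ?A" and lin: "\<And>a b. a \<in> C \<Longrightarrow> b \<in> C \<Longrightarrow> a \<le> b \<or> b \<le> a"
      using C unfolding Chains_def relation_of_def by blast+
    show "\<exists>u\<in>?A. \<forall>a\<in>C. u \<le> a"
    proof (cases "C = {}")
      case True
      then show ?thesis using p by blast
    next
      case False
      let ?g = "\<lambda>x. INF q\<in>C. q x"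
      have bdd: "bdd_below ((\<lambda>q. q x) ` C)" for x
      proof (rule bdd_belowI2)
        fix q assume "q \<in> C"
        then have "sublinear q" "q (- x) \<le> p (- x)"
          using CA by (auto simp: le_fun_def)
        then show "- p (- x) \<le> q x"
          using sublinear_minus[of q x] by linarith
      qed
      have "sublinear ?g"
      proof (rule sublinear_Inf[OF False _ bdd])
        fix a b assume "a \<in> C" "b \<in> C"
        then show "\<exists>c\<in>C. c \<le> a \<and> c \<le> b"
          using lin[of a b] by blast
      qed (use CA in auto)
      moreover have low: "?g \<le> q" if "q \<in> C" for q
        using that by (intro le_funI cINF_lower[OF bdd])
      moreover have "?g \<le> p"
      proof -
        obtain q where "q \<in> C" using False by blast
        with CA low[of q] show ?thesis by (auto intro: order_trans)
      qed
      ultimately show ?thesis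
        by (intro bexI[of _ ?g]) auto
    qed
  qed
  then obtain q where q: "sublinear q" "q \<le> p"
    and min: "\<And>a. sublinear a \<Longrightarrow> a \<le> p \<Longrightarrow> a \<le> q \<Longrightarrow> a = q"
    by blast
  have "q x + q v \<le> q (x + v)" for x v
  proof -
    have le: "lowering q v \<le> q"
      using lowering_le[OF q(1), of 0 v] by (auto simp: le_fun_def)
    have "lowering q v = q"
      using sublinear_lowering[OF q(1)] order_trans[OF le q(2)] le by (rule min)
    then show ?thesis
      using lowering_le[OF q(1), of 1 v x] by simp
  qed
  with sublinearD(1)[OF q(1)] have add: "q (x + y) = q x + q y" for x y
    by (simp add: antisym)
  have neg: "q (- x) = - q x" for x
    using add[of x "- x"] sublinear_zero[OF q(1)] by simp
  have "q (c *\<^sub>R x) = c * q x" for c x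
  proof (cases "0 \<le> c")
    case True
    then show ?thesis by (rule sublinearD(2)[OF q(1)])
  next
    case False
    then show ?thesis
      using sublinearD(2)[OF q(1), of "- c" x] neg[of "c *\<^sub>R x"] by simp
  qed
  then have "linear q"
    using add by (intro linearI) auto
  with q(2) that show ?thesis
    by (auto simp: le_fun_def)
qed

text \<open>A linear functional below \<open>lowering p v\<close> is below \<open>p\<close>, and at
  \<open>- v\<close> the parameter \<open>t = 1\<close> bounds it by \<open>- p v\<close>, which
  forces equality at \<open>v\<close>.\<close>

lemma Hahn_Banach_at_point:
  fixes p :: "'a::real_vector \<Rightarrow> real"
  assumes p: "sublinear p"
  obtains f where "linear f" "\<And>x. f x \<le> p x" "f v = p v"
proof -
  obtain f where f: "linear f" "\<And>x. f x \<le> lowering p v x"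
    using sublinear_dominates_linear[OF sublinear_lowering[OF p]] by blast
  have le: "f x \<le> p x" for x
    using f(2)[of x] lowering_le[OF p, of 0 v x] by simp
  have "- f v \<le> - p v"
    using f(2)[of "- v"] lowering_le[OF p, of 1 v "- v"] sublinear_zero[OF p]
    by (simp add: linear_neg[OF f(1)])
  with le[of v] have "f v = p v" by simp
  with f(1) le that show ?thesis by blast
qed

section \<open>Distance to a subspace and continuous functionals\<close>

lemma sublinear_infdist_subspace:
  fixes E :: "'a::real_normed_vector set"
  assumes E: "subspace E"
  shows "sublinear (\<lambda>x. infdist x E)"
proof -
  have ne: "E \<noteq> {}" using subspace_0[OF E] by blast
  have approx: "\<exists>a\<in>E. dist x a < infdist x E + e" if "0 < e" for x e
    using cINF_less_iff[of E "dist x" "infdist x E + e"] ne that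
    by (simp add: infdist_notempty[OF ne])
  have "infdist (x + y) E \<le> infdist x E + infdist y E" for x y
  proof (rule field_le_epsilon)
    fix e :: real assume "0 < e"
    then obtain a b where ab: "a \<in> E" "dist x a < infdist x E + e / 2"
      "b \<in> E" "dist y b < infdist y E + e / 2"
      using approx[of "e / 2"] by (meson half_gt_zero)
    have "infdist (x + y) E \<le> dist (x + y) (a + b)"
      using ab by (intro infdist_le subspace_add[OF E])
    also have "\<dots> \<le> dist x a + dist y b"
      by (rule dist_triangle_add)
    finally show "infdist (x + y) E \<le> infdist x E + infdist y E + e"
      using ab by linarith
  qed
  moreover have "infdist (c *\<^sub>R x) E = c * infdist x E" if "0 \<le> c" for c x
  proof (cases "c = 0")
    case True
    then show ?thesis using subspace_0[OF E] by simp
  next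
    case False
    with that have c: "0 < c" by simp
    have le: "infdist (c *\<^sub>R x) E \<le> c * infdist x E" if c: "0 < c" for c x
    proof -
      have "infdist (c *\<^sub>R x) E / c \<le> infdist x E"
        unfolding infdist_notempty[OF ne, of x] using ne
      proof (rule cINF_greatest)
        fix a assume "a \<in> E"
        then have "infdist (c *\<^sub>R x) E \<le> dist (c *\<^sub>R x) (c *\<^sub>R a)"
          by (intro infdist_le subspace_scale[OF E])
        also have "\<dots> = c * dist x a" 
          using c by (simp add: dist_norm flip: scaleR_diff_right)
        finally show "infdist (c *\<^sub>R x) E / c \<le> dist x a"
          using c by (simp add: field_simps)
      qed
      then show ?thesis using c by (simp add: field_simps)
    qed
    have "infdist x E \<le> inverse c * infdist (c *\<^sub>R x) E"
      using le[of "inverse c" "c *\<^sub>R x"] c by simp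
    then have "c * infdist x E \<le> infdist (c *\<^sub>R x) E"
      using c by (simp add: field_simps)
    with le[OF c, of x] show ?thesis by simp
  qed
  ultimately show ?thesis
    unfolding sublinear_def by blast
qed

text \<open>Domination by the distance to \<open>E\<close> makes the functional vanish on
  \<open>E\<close> and, as \<open>0 \<in> E\<close>, bounds it by the norm. For
  \<open>E = {0}\<close> it is a norming functional for \<open>v\<close>.\<close>

lemma Hahn_Banach_infdist:
  fixes E :: "'a::real_normed_vector set"
  assumes E: "subspace E"
  obtains \<phi> :: "'a \<Rightarrow>\<^sub>L real"
  where "\<phi> v = infdist v E" "\<And>e. e \<in> E \<Longrightarrow> \<phi> e = 0" "\<And>x. \<bar>\<phi> x\<bar> \<le> norm x"
proof -
  obtain f where f: "linear f" "\<And>x. f x \<le> infdist x E" "f v = infdist v E"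
    using Hahn_Banach_at_point[OF sublinear_infdist_subspace[OF E]] by blast
  have minus: "f (- x) = - f x" for x by (rule linear_neg[OF f(1)])
  have "infdist x E \<le> norm x" for x
    using infdist_le[OF subspace_0[OF E], of x] by simp
  then have "f x \<le> norm x" for x using f(2) order_trans by blast
  then have bd: "\<bar>f x\<bar> \<le> norm x" for x
    by (metis abs_le_iff minus norm_minus_cancel)
  have "bounded_linear f"
    by (rule bounded_linear_intro[of _ 1]) (use bd linear_add[OF f(1)] linear_scale[OF f(1)] in auto)
  then have ap: "blinfun_apply (Blinfun f) = f" by (rule bounded_linear_Blinfun_apply)
  have "f e = 0" if "e \<in> E" for e
    using f(2)[of e] f(2)[of "- e"] that subspace_neg[OF E that] by (simp add: minus)
  then show thesis
    using that[of "Blinfun f"] f(3) bd by (simp add: ap)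
qed

section \<open>Weak limits\<close>

definition weakly_tendsto :: "('i \<Rightarrow> 'a::real_normed_vector) \<Rightarrow> 'a \<Rightarrow> 'i filter \<Rightarrow> bool" where
  "weakly_tendsto h z U \<longleftrightarrow> (\<forall>\<phi> :: 'a \<Rightarrow>\<^sub>L real. ((\<lambda>n. \<phi> (h n)) \<longlongrightarrow> \<phi> z) U)"

lemma weakly_tendsto_diff:
  "weakly_tendsto g y U \<Longrightarrow> weakly_tendsto h z U \<Longrightarrow> weakly_tendsto (\<lambda>n. g n - h n) (y - z) U"
  unfolding weakly_tendsto_def by (simp add: blinfun.diff_right tendsto_diff)

lemma weakly_tendsto_const: "weakly_tendsto (\<lambda>_. z) z U"
  unfolding weakly_tendsto_def by simp

text \<open>Weak lower semicontinuity of the norm, tested on a norming functional for the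
  limit.\<close>

lemma weakly_tendsto_norm_le:
  assumes "weakly_tendsto h z U" "U \<noteq> bot" "\<And>n. norm (h n) \<le> C"
  shows "norm z \<le> C"
proof -
  obtain \<phi> :: "'b \<Rightarrow>\<^sub>L real" where \<phi>: "\<phi> z = norm z" "\<And>x. \<bar>\<phi> x\<bar> \<le> norm x"
    using Hahn_Banach_infdist[of "{0}" z] by auto
  have "((\<lambda>n. \<phi> (h n)) \<longlongrightarrow> norm z) U"
    using assms(1) \<phi>(1) unfolding weakly_tendsto_def by metis
  moreover have "\<phi> (h n) \<le> C" for n
    using \<phi>(2)[of "h n"] assms(3)[of n] by linarith
  ultimately show ?thesis
    using assms(2) by (intro tendsto_upperbound) auto
qed

text \<open>Each functional has a limit along the ultrafilter by compactness of intervals. These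
  limits form a bounded functional on the dual, which reflexivity represents by a vector.\<close>

lemma reflexive_weak_limit:
  fixes y :: "'i \<Rightarrow> 'a::real_normed_vector"
  assumes refl: "reflexive_space TYPE('a)" and U: "ultrafilter U" and bd: "bounded (range y)"
  obtains z where "weakly_tendsto y z U"
proof -
  obtain C where C: "\<And>n. norm (y n) \<le> C"
    using bd by (auto simp: bounded_iff)
  have bot: "U \<noteq> bot" using U by (simp add: ultrafilter_def)
  have le: "\<bar>\<phi> (y n)\<bar> \<le> norm \<phi> * C" for \<phi> :: "'a \<Rightarrow>\<^sub>L real" and n
    using norm_blinfun[of \<phi> "y n"] C[of n] by (metis mult_left_mono norm_ge_zero order_trans real_norm_def)
  have "\<exists>l. ((\<lambda>n. \<phi> (y n)) \<longlongrightarrow> l) U" for \<phi> :: "'a \<Rightarrow>\<^sub>L real"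
    by (rule ultrafilter_compact_tendsto[OF U, of "{- (norm \<phi> * C)..norm \<phi> * C}" "\<lambda>n. \<phi> (y n)"])
       (use le[of \<phi>] in \<open>auto simp: abs_le_iff minus_le_iff\<close>)
  then obtain \<Lambda> :: "('a \<Rightarrow>\<^sub>L real) \<Rightarrow> real" where \<Lambda>: "\<And>\<phi>. ((\<lambda>n. blinfun_apply \<phi> (y n)) \<longlongrightarrow> \<Lambda> \<phi>) U"
    by metis
  have "bounded_linear \<Lambda>"
  proof (rule bounded_linear_intro)
    fix \<phi> \<psi> :: "'a \<Rightarrow>\<^sub>L real" and c :: real
    have "((\<lambda>n. blinfun_apply (\<phi> + \<psi>) (y n)) \<longlongrightarrow> \<Lambda> \<phi> + \<Lambda> \<psi>) U"
      unfolding blinfun.add_left by (intro tendsto_add \<Lambda>)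
    then show "\<Lambda> (\<phi> + \<psi>) = \<Lambda> \<phi> + \<Lambda> \<psi>"
      using \<Lambda> bot tendsto_unique by blast
    have "((\<lambda>n. blinfun_apply (c *\<^sub>R \<phi>) (y n)) \<longlongrightarrow> c *\<^sub>R \<Lambda> \<phi>) U"
      unfolding blinfun.scaleR_left by (intro tendsto_scaleR \<Lambda> tendsto_const)
    then show "\<Lambda> (c *\<^sub>R \<phi>) = c *\<^sub>R \<Lambda> \<phi>"
      using \<Lambda> bot tendsto_unique by blast
    have "\<bar>\<Lambda> \<phi>\<bar> \<le> norm \<phi> * C"
      using tendsto_rabs[OF \<Lambda>[of \<phi>]] le bot by (intro tendsto_upperbound[of _ _ U]) auto
    then show "norm (\<Lambda> \<phi>) \<le> norm \<phi> * C" by simp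
  qed
  then have "blinfun_apply (Blinfun \<Lambda>) = \<Lambda>" by (rule bounded_linear_Blinfun_apply)
  moreover obtain z where "\<And>\<phi>. blinfun_apply (Blinfun \<Lambda>) \<phi> = blinfun_apply \<phi> z"
    using refl unfolding reflexive_space_def by blast
  ultimately have "weakly_tendsto y z U"
    unfolding weakly_tendsto_def using \<Lambda> by simp
  then show thesis by (rule that)
qed

text \<open>Induction on \<open>F\<close>, which spans the space modulo \<open>E\<close>. A vector
  \<open>v\<close> outside \<open>E\<close> is absorbed into a larger closed subspace
  \<open>E'\<close>; the component along \<open>v\<close> is measured by a continuous functional,
  which tends to 0 along \<open>h\<close>.\<close>

lemma weakly_null_infdist_fin_codim:
  fixes h :: "'i \<Rightarrow> 'a::real_normed_vector"
  assumes h: "weakly_tendsto h 0 U" and "finite F"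
    and "subspace E" "closed E" "\<forall>y. \<exists>e\<in>E. y - e \<in> span F"
  shows "((\<lambda>n. infdist (h n) E) \<longlongrightarrow> 0) U"
  using assms(2-)
proof (induction F arbitrary: E rule: finite_induct)
  case empty
  then have "E = UNIV" by auto
  then show ?case by simp
next
  case (insert v F)
  note E = \<open>subspace E\<close> \<open>closed E\<close>
  have ne: "E \<noteq> {}" using subspace_0[OF E(1)] by blast
  have cover: "\<exists>e\<in>E. \<exists>k. y - (e + k *\<^sub>R v) \<in> span F" for y
    using insert.prems(3) by (auto simp: span_breakdown_eq algebra_simps)
  show ?case
  proof (cases "v \<in> E")
    case True
    have "\<exists>e\<in>E. y - e \<in> span F" for y
      using cover[of y] subspace_add[OF E(1)] subspace_scale[OF E(1) True] by blast
    then show ?thesis using insert.IH[OF E] by blast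
  next
    case False
    define \<delta> where "\<delta> = infdist v E"
    have \<delta>: "0 < \<delta>"
      using False E(2) ne infdist_pos_not_in_closed unfolding \<delta>_def by blast
    obtain \<phi> :: "'a \<Rightarrow>\<^sub>L real" where \<phi>: "\<phi> v = \<delta>" "\<And>e. e \<in> E \<Longrightarrow> \<phi> e = 0" "\<And>x. \<bar>\<phi> x\<bar> \<le> norm x"
      using Hahn_Banach_infdist[OF E(1), of v] unfolding \<delta>_def by metis
    \<comment> \<open>\<open>T\<close> fixes \<open>E\<close> and kills \<open>v\<close>, so
      \<open>E'\<close> is the sum of \<open>E\<close> and the line through \<open>v\<close>.
      Writing it as a preimage makes it closed by continuity of \<open>T\<close>.\<close>
    define T where "T x = x - (\<phi> x / \<delta>) *\<^sub>R v" for x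
    define E' where "E' = T -` E"
    have linT: "linear T"
      by (rule linearI)
        (simp_all add: T_def blinfun.add_right blinfun.scaleR_right add_divide_distrib
          scaleR_add_left scaleR_diff_right)
    have "subspace E'"
      unfolding E'_def using linT E(1) by (rule linear_subspace_vimage)
    moreover have "closed E'"
    proof -
      have "continuous_on UNIV T"
        unfolding T_def divide_inverse
        by (intro continuous_on_diff continuous_on_scaleR continuous_on_mult continuous_on_id
            continuous_on_const linear_continuous_on blinfun.bounded_linear_right)
      with E(2) show ?thesis unfolding E'_def by (rule closed_vimage)
    qed
    moreover have "\<exists>e\<in>E'. y - e \<in> span F" for y
    proof -
      obtain e k where e: "e \<in> E" "y - (e + k *\<^sub>R v) \<in> span F" using cover by blast
      have "T (e + k *\<^sub>R v) = e"
        using \<delta> \<phi>(1) \<phi>(2)[OF e(1)] by (simp add: T_def blinfun.add_right blinfun.scaleR_right)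
      with e show ?thesis by (auto simp: E'_def intro!: bexI[of _ "e + k *\<^sub>R v"])
    qed
    ultimately have lim: "((\<lambda>n. infdist (h n) E') \<longlongrightarrow> 0) U"
      using insert.IH by blast
    define K where "K = norm v / \<delta>"
    have K: "0 \<le> K" using \<delta> by (simp add: K_def)
    have ne': "E' \<noteq> {}" using \<open>subspace E'\<close> subspace_0 by blast
    \<comment> \<open>A point \<open>a\<close> of \<open>E'\<close> is moved into \<open>E\<close>
      by \<open>T\<close> at cost at most \<open>\<bar>\<phi> a\<bar> * K\<close>, and
      \<open>\<phi> a\<close> differs from \<open>\<phi> x\<close> by at most
      \<open>dist x a\<close>.\<close>
    have bound: "infdist x E \<le> (1 + K) * infdist x E' + \<bar>\<phi> x\<bar> * K" for x
    proof -
      have "(infdist x E - \<bar>\<phi> x\<bar> * K) / (1 + K) \<le> infdist x E'"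
        unfolding infdist_notempty[OF ne', of x] using ne'
      proof (rule cINF_greatest)
        fix a assume "a \<in> E'"
        then have "infdist x E \<le> dist x (T a)" by (intro infdist_le) (simp add: E'_def)
        also have "\<dots> = norm ((x - a) + (\<phi> a / \<delta>) *\<^sub>R v)" by (simp add: T_def dist_norm algebra_simps)
        also have "\<dots> \<le> dist x a + \<bar>\<phi> a\<bar> * K"
          using \<delta> norm_triangle_ineq[of "x - a" "(\<phi> a / \<delta>) *\<^sub>R v"] by (simp add: K_def dist_norm)
        also have "\<bar>\<phi> a\<bar> \<le> \<bar>\<phi> x\<bar> + dist x a"
          using \<phi>(3)[of "x - a"] by (simp add: dist_norm blinfun.diff_right)
        finally have "infdist x E \<le> dist x a + (\<bar>\<phi> x\<bar> + dist x a) * K"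
          using K by (simp add: mult_right_mono)
        then show "(infdist x E - \<bar>\<phi> x\<bar> * K) / (1 + K) \<le> dist x a"
          using K by (simp add: divide_le_eq algebra_simps)
      qed
      then show ?thesis using K by (simp add: divide_le_eq algebra_simps)
    qed
    have "((\<lambda>n. \<phi> (h n)) \<longlongrightarrow> 0) U"
      using h unfolding weakly_tendsto_def by (metis blinfun.zero_right)
    then have "((\<lambda>n. (1 + K) * infdist (h n) E' + \<bar>\<phi> (h n)\<bar> * K) \<longlongrightarrow> (1 + K) * 0 + \<bar>0\<bar> * K) U"
      by (intro tendsto_intros lim)
    then have lim0: "((\<lambda>n. (1 + K) * infdist (h n) E' + \<bar>\<phi> (h n)\<bar> * K) \<longlongrightarrow> 0) U"
      by simp
    show ?thesis
      by (rule tendsto_sandwich[OF _ _ tendsto_const lim0]) (simp_all add: infdist_nonneg bound)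
  qed
qed

section \<open>Asymptotic uniform smoothness\<close>

text \<open>Infinite dimension makes every such subspace nonzero, so the suprema in
  \<open>aus_modulus\<close> range over nonempty sets.\<close>

lemma fin_codim_sphere_nonempty:
  fixes E :: "'a::real_normed_vector set"
  assumes "infinite_dimensional TYPE('a)" "E \<in> fin_codim_subspaces"
  shows "E \<inter> sphere 0 1 \<noteq> {}"
proof -
  have E: "subspace E" using assms(2) by (simp add: fin_codim_subspaces_def)
  obtain F where F: "finite F" "\<And>y. \<exists>e\<in>E. y - e \<in> span F"
    using assms(2) unfolding fin_codim_subspaces_def by blast
  have "\<not> E \<subseteq> {0}"
  proof
    assume "E \<subseteq> {0}"
    then have "y \<in> span F" for y using F(2)[of y] by auto
    then show False using F(1) assms(1) unfolding infinite_dimensional_def by blast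
  qed
  then obtain e where "e \<in> E" "e \<noteq> 0" by blast
  then have "e /\<^sub>R norm e \<in> E \<inter> sphere 0 1"
    using subspace_scale[OF E] by simp
  then show ?thesis by blast
qed

text \<open>The infimum over subspaces need not be attained, hence the strict slack
  \<open>c\<close>. Most of the proof checks that the real suprema and infima are over bounded sets:
  values lie between \<open>- 1\<close> and \<open>\<bar>t\<bar>\<close>.\<close>

lemma aus_modulus_subspace:
  fixes x :: "'a::real_normed_vector"
  assumes inf: "infinite_dimensional TYPE('a)" and x: "norm x = 1" and c: "aus_modulus TYPE('a) t < c"
  obtains E where "E \<in> fin_codim_subspaces" "\<And>h. h \<in> E \<Longrightarrow> norm h = 1 \<Longrightarrow> norm (x + t *\<^sub>R h) \<le> 1 + c"
proof -
  let ?S = "\<lambda>(x::'a) E. SUP h\<in>(E \<inter> sphere 0 1). norm (x + t *\<^sub>R h) - 1"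
  let ?I = "\<lambda>x::'a. INF E\<in>fin_codim_subspaces. ?S x E"
  have up: "norm (x + t *\<^sub>R h) - 1 \<le> \<bar>t\<bar>" if "norm x = 1" "norm h = 1" for x h :: 'a
    using norm_triangle_ineq[of x "t *\<^sub>R h"] that by simp
  have bddS: "bdd_above ((\<lambda>h. norm (x + t *\<^sub>R h) - 1) ` (E \<inter> sphere 0 1))" if "norm x = 1" for x :: 'a and E
    using up[OF that] by (intro bdd_aboveI2[of _ _ "\<bar>t\<bar>"]) auto
  have univ: "(UNIV :: 'a set) \<in> fin_codim_subspaces"
    unfolding fin_codim_subspaces_def by (auto intro!: exI[of _ "{}"])
  have bddI: "bdd_below (?S x ` fin_codim_subspaces)" if "norm x = 1" for x :: 'a
  proof (rule bdd_belowI2)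
    fix E :: "'a set" assume "E \<in> fin_codim_subspaces"
    then obtain h where "h \<in> E \<inter> sphere 0 1" using fin_codim_sphere_nonempty[OF inf] by blast
    from cSUP_upper[OF this bddS[OF that]] show "- 1 \<le> ?S x E"
      by (rule order_trans[rotated]) simp
  qed
  have "?I x \<le> \<bar>t\<bar>" if "norm x = 1" for x :: 'a
  proof -
    have "?I x \<le> ?S x UNIV" using bddI[OF that] univ by (rule cINF_lower)
    also have "\<dots> \<le> \<bar>t\<bar>"
      using fin_codim_sphere_nonempty[OF inf univ] up[OF that] by (intro cSUP_least) auto
    finally show ?thesis .
  qed
  then have "bdd_above (?I ` sphere 0 1)"
    by (intro bdd_aboveI2[of _ _ "\<bar>t\<bar>"]) auto
  then have "?I x \<le> aus_modulus TYPE('a) t"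
    unfolding aus_modulus_def using x by (intro cSUP_upper) auto
  with c have "?I x < c" by simp
  then obtain E where E: "E \<in> fin_codim_subspaces" "?S x E < c"
    using cINF_less_iff[of fin_codim_subspaces "?S x" c] bddI[OF x] univ by blast
  have "norm (x + t *\<^sub>R h) \<le> 1 + c" if "h \<in> E" "norm h = 1" for h
    using cSUP_upper[OF _ bddS[OF x], of h E] that E(2) by simp
  with E(1) that show thesis by blast
qed

text \<open>Convexity extends the bound from radius exactly \<open>t\<close> to the whole ball:
  \<open>x + e\<close> is a convex combination of \<open>x + t *\<^sub>R u\<close> and
  \<open>x - t *\<^sub>R u\<close>, with \<open>u\<close> a unit vector in the direction of
  \<open>e\<close> (any unit vector of \<open>E\<close> if \<open>e = 0\<close>).\<close>

lemma norm_add_le_of_sphere: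
  fixes x :: "'a::real_normed_vector"
  assumes E: "subspace E" "E \<inter> sphere 0 1 \<noteq> {}" and t: "0 < t"
    and c: "\<And>h. h \<in> E \<Longrightarrow> norm h = 1 \<Longrightarrow> norm (x + t *\<^sub>R h) \<le> c"
    and e: "e \<in> E" "norm e \<le> t"
  shows "norm (x + e) \<le> c"
proof -
  define a where "a = norm e / t"
  have a: "0 \<le> a" "a \<le> 1" using e(2) t by (auto simp: a_def)
  obtain u where u: "u \<in> E" "norm u = 1" "e = (a * t) *\<^sub>R u"
  proof (cases "e = 0")
    case True
    then show thesis using E(2) that by (auto simp: a_def)
  next
    case False
    then show thesis
      using t e(1) subspace_scale[OF E(1)] by (intro that[of "e /\<^sub>R norm e"]) (auto simp: a_def)
  qed
  have "x + e = ((1 + a) / 2) *\<^sub>R (x + t *\<^sub>R u) + ((1 - a) / 2) *\<^sub>R (x + t *\<^sub>R (- u))"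
    by (simp add: u(3) algebra_simps add_divide_distrib diff_divide_distrib flip: scaleR_add_left scaleR_diff_left)
  also have "norm \<dots> \<le> ((1 + a) / 2) * norm (x + t *\<^sub>R u) + ((1 - a) / 2) * norm (x + t *\<^sub>R (- u))"
    using a by (intro norm_triangle_le) simp
  also have "\<dots> \<le> ((1 + a) / 2) * c + ((1 - a) / 2) * c"
    using a u c[of u] c[of "- u"] subspace_neg[OF E(1)] by (intro add_mono mult_left_mono) auto
  also have "\<dots> = c" by (simp add: field_simps)
  finally show ?thesis .
qed

text \<open>Relative to a long vector \<open>x\<close>, a perturbation of size
  \<open>\<kappa>\<close> is small, so smoothness gives a gain of small order
  \<open>\<epsilon> * \<kappa>\<close>, after moving \<open>h n\<close> into a good subspace of
  finite codimension. The threshold \<open>B0\<close> is uniform in \<open>x\<close>,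
  \<open>h\<close> and \<open>U\<close>.\<close>

lemma aus_weakly_null_growth:
  fixes \<kappa> \<epsilon> :: real
  assumes inf: "infinite_dimensional TYPE('a::real_normed_vector)"
    and aus: "asymptotically_uniformly_smooth TYPE('a)"
    and \<kappa>: "0 < \<kappa>" and \<epsilon>: "0 < \<epsilon>"
  obtains B0 where "0 < B0"
    "\<And>B (x::'a) (h::'i \<Rightarrow> 'a) U. B0 \<le> B \<Longrightarrow> norm x < B \<Longrightarrow> weakly_tendsto h 0 U \<Longrightarrow>
       (\<And>n. norm (h n) \<le> \<kappa>) \<Longrightarrow> eventually (\<lambda>n. norm (x + h n) < B + \<epsilon> * \<kappa>) U"
proof -
  have "eventually (\<lambda>t. aus_modulus TYPE('a) t / t < \<epsilon> / 2) (at_right 0)"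
    using aus \<epsilon> unfolding asymptotically_uniformly_smooth_def by (intro order_tendstoD(2)) auto
  then obtain t0 where t0: "0 < t0" "\<And>t. 0 < t \<Longrightarrow> t < t0 \<Longrightarrow> aus_modulus TYPE('a) t / t < \<epsilon> / 2"
    by (auto simp: eventually_at_right_field)
  \<comment> \<open>Either \<open>norm x\<close> is so far below \<open>B\<close> that the triangle
    inequality suffices, or it exceeds \<open>B - \<kappa>\<close>, hence
    \<open>2 * \<kappa> / t0\<close>, and the relative size \<open>t\<close> below is less than
    \<open>t0\<close>.\<close>
  let ?B0 = "\<kappa> + 2 * \<kappa> / t0"
  show thesis
  proof (rule that)
    show "0 < ?B0" using \<kappa> t0(1) by (simp add: add_pos_pos)
    fix B and x :: 'a and h :: "'i \<Rightarrow> 'a" and U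
    assume B: "?B0 \<le> B" "norm x < B" and h: "weakly_tendsto h 0 U" "\<And>n. norm (h n) \<le> \<kappa>"
    let ?r = "norm x"
    show "eventually (\<lambda>n. norm (x + h n) < B + \<epsilon> * \<kappa>) U"
    proof (cases "?r + \<kappa> < B + \<epsilon> * \<kappa>")
      case True
      have "norm (x + h n) < B + \<epsilon> * \<kappa>" for n
        using norm_triangle_ineq[of x "h n"] h(2)[of n] True by linarith
      then show ?thesis by simp
    next
      case False
      have "0 < \<epsilon> * \<kappa>" using \<epsilon> \<kappa> by simp
      with False B have r: "2 * \<kappa> / t0 < ?r" by linarith
      have rpos: "0 < ?r" using r \<kappa> t0(1) by (smt (verit) divide_nonneg_nonneg)
      \<comment> \<open>\<open>\<eta>\<close> is spent twice, on the infimum in the modulus and on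
        the distance of \<open>h n\<close> to \<open>E\<close>, and also enlarges \<open>t\<close>.
        The total error \<open>\<epsilon> / 2 * (\<kappa> + \<eta>) + 2 * \<eta>\<close> must stay
        within \<open>\<epsilon> * \<kappa>\<close>.\<close>
      define \<eta> where "\<eta> = min \<kappa> (\<epsilon> * \<kappa> / (\<epsilon> + 4))"
      have \<eta>: "0 < \<eta>" "\<eta> \<le> \<kappa>" using \<kappa> \<epsilon> by (auto simp: \<eta>_def)
      have "\<eta> \<le> \<epsilon> * \<kappa> / (\<epsilon> + 4)" by (simp add: \<eta>_def)
      then have \<eta>': "\<epsilon> * \<eta> + 4 * \<eta> \<le> \<epsilon> * \<kappa>" using \<epsilon> by (simp add: field_simps)
      define t where "t = (\<kappa> + \<eta>) / ?r"
      have tpos: "0 < t" using \<kappa> \<eta> rpos by (simp add: t_def)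
      have "t \<le> 2 * \<kappa> / ?r" unfolding t_def using \<eta> rpos by (intro divide_right_mono) auto
      also have "\<dots> < t0" using r rpos t0(1) by (simp add: field_simps)
      finally have "t < t0" .
      then have \<rho>: "aus_modulus TYPE('a) t < \<epsilon> / 2 * t"
        using t0(2)[of t] tpos by (simp add: divide_less_eq)
      have "norm (x /\<^sub>R ?r) = 1" using rpos by simp
      moreover have "aus_modulus TYPE('a) t < aus_modulus TYPE('a) t + \<eta> / ?r" using \<eta> rpos by simp
      ultimately obtain E where E: "E \<in> fin_codim_subspaces"
        and Ebd: "\<And>h. h \<in> E \<Longrightarrow> norm h = 1 \<Longrightarrow>
          norm (x /\<^sub>R ?r + t *\<^sub>R h) \<le> 1 + (aus_modulus TYPE('a) t + \<eta> / ?r)"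
        using aus_modulus_subspace[OF inf] by metis
      have sub: "subspace E" and cl: "closed E" using E by (auto simp: fin_codim_subspaces_def)
      obtain F where F: "finite F" "\<forall>y. \<exists>e\<in>E. y - e \<in> span F"
        using E by (auto simp: fin_codim_subspaces_def)
      have "eventually (\<lambda>n. infdist (h n) E < \<eta>) U"
        using weakly_null_infdist_fin_codim[OF h(1) F(1) sub cl F(2)] \<eta>(1) by (rule order_tendstoD(2))
      then show ?thesis
      proof (rule eventually_mono)
        fix n assume n: "infdist (h n) E < \<eta>"
        have ne: "E \<noteq> {}" using subspace_0[OF sub] by blast
        obtain e where e: "e \<in> E" "dist (h n) e < \<eta>"
          using n cINF_less_iff[of E "dist (h n)" \<eta>] ne by (auto simp: infdist_notempty[OF ne])
        have ne: "norm e \<le> \<kappa> + \<eta>"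
          using e(2) h(2)[of n] norm_triangle_sub[of e "h n"] by (simp add: dist_norm norm_minus_commute)
        have "norm (x /\<^sub>R ?r + e /\<^sub>R ?r) \<le> 1 + (aus_modulus TYPE('a) t + \<eta> / ?r)"
        proof (rule norm_add_le_of_sphere[OF sub fin_codim_sphere_nonempty[OF inf E] tpos Ebd])
          show "e /\<^sub>R ?r \<in> E" using e(1) by (rule subspace_scale[OF sub])
          show "norm (e /\<^sub>R ?r) \<le> t"
            using ne rpos by (simp add: t_def divide_inverse mult.commute mult_left_mono)
        qed
        then have "norm ((x + e) /\<^sub>R ?r) \<le> 1 + (aus_modulus TYPE('a) t + \<eta> / ?r)"
          by (simp only: scaleR_add_right)
        then have "norm (x + e) / ?r \<le> 1 + (aus_modulus TYPE('a) t + \<eta> / ?r)"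
          by (simp add: divide_inverse mult.commute)
        then have "norm (x + e) \<le> ?r + ?r * aus_modulus TYPE('a) t + \<eta>"
          using rpos by (simp add: field_simps)
        moreover have "?r * aus_modulus TYPE('a) t < \<epsilon> / 2 * (\<kappa> + \<eta>)"
          using \<rho> rpos by (simp add: t_def field_simps)
        moreover have "norm (x + h n) \<le> norm (x + e) + dist (h n) e"
          using norm_triangle_ineq[of "x + e" "h n - e"] by (simp add: dist_norm)
        ultimately show "norm (x + h n) < B + \<epsilon> * \<kappa>"
          using e(2) \<eta>' B(2) by (simp add: algebra_simps)
      qed
    qed
  qed
qed

section \<open>Concentration of Hamming-Lipschitz maps\<close>

text \<open>An arbitrary choice, meaningful only where a weak limit exists; bounded families in a
  reflexive space have one along an ultrafilter.\<close>

definition weak_limit :: "'i filter \<Rightarrow> ('i \<Rightarrow> 'a::real_normed_vector) \<Rightarrow> 'a" where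
  "weak_limit U y = (SOME z. weakly_tendsto y z U)"

lemma weakly_tendsto_weak_limit:
  fixes y :: "'i \<Rightarrow> 'a::real_normed_vector"
  assumes "reflexive_space TYPE('a)" "ultrafilter U" "bounded (range y)"
  shows "weakly_tendsto y (weak_limit U y) U"
  unfolding weak_limit_def using reflexive_weak_limit[OF assms] by (metis someI_ex)

text \<open>\<open>d\<close> counts the removed variables: the value at \<open>l\<close> is the
  limit of \<open>F (l @ [m1, ..., md])\<close>, with the limit in \<open>md\<close> taken
  innermost.\<close>

fun iterated_weak_limit ::
  "'i filter \<Rightarrow> ('i list \<Rightarrow> 'a::real_normed_vector) \<Rightarrow> nat \<Rightarrow> 'i list \<Rightarrow> 'a" where
  "iterated_weak_limit U F 0 l = F l"
| "iterated_weak_limit U F (Suc d) l = weak_limit U (\<lambda>m. iterated_weak_limit U F d (l @ [m]))"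

text \<open>Changing one coordinate is enough, by the triangle inequality along a path of such
  changes; lists of all lengths share the constant.\<close>

definition hamming_lipschitz :: "real \<Rightarrow> ('i list \<Rightarrow> 'a::real_normed_vector) \<Rightarrow> bool" where
  "hamming_lipschitz \<kappa> F \<longleftrightarrow> (\<forall>a m m' b. norm (F (a @ m # b) - F (a @ m' # b)) \<le> \<kappa>)"

lemma hamming_lipschitz_bounded_last:
  assumes "hamming_lipschitz \<kappa> F"
  shows "bounded (range (\<lambda>m. F (l @ [m])))"
proof -
  have "dist (F (l @ [undefined])) (F (l @ [m])) \<le> \<kappa>" for m
    using assms unfolding hamming_lipschitz_def dist_norm by blast
  then show ?thesis unfolding bounded_def by blast
qed

context
  fixes U :: "'i filter" and F :: "'i list \<Rightarrow> 'a::real_normed_vector" and \<kappa> :: real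
  assumes refl: "reflexive_space TYPE('a)" and U: "ultrafilter U" and F: "hamming_lipschitz \<kappa> F"
begin

text \<open>The Lipschitz bound survives each weak limit by lower semicontinuity of the norm; it
  also supplies the boundedness needed for the next limit to exist.\<close>

lemma hamming_lipschitz_iterated_weak_limit: "hamming_lipschitz \<kappa> (iterated_weak_limit U F d)"
proof (induction d)
  case 0
  then show ?case using F by (simp add: hamming_lipschitz_def)
next
  case (Suc d)
  let ?G = "iterated_weak_limit U F d"
  have lim: "weakly_tendsto (\<lambda>m. ?G (l @ [m])) (weak_limit U (\<lambda>m. ?G (l @ [m]))) U" for l
    by (rule weakly_tendsto_weak_limit[OF refl U hamming_lipschitz_bounded_last[OF Suc]])
  have "norm (iterated_weak_limit U F (Suc d) (a @ m # b) - iterated_weak_limit U F (Suc d) (a @ m' # b)) \<le> \<kappa>"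
    for a m m' b
  proof (simp only: iterated_weak_limit.simps, rule weakly_tendsto_norm_le)
    show "weakly_tendsto (\<lambda>n. ?G ((a @ m # b) @ [n]) - ?G ((a @ m' # b) @ [n]))
       (weak_limit U (\<lambda>n. ?G ((a @ m # b) @ [n])) - weak_limit U (\<lambda>n. ?G ((a @ m' # b) @ [n]))) U"
      by (intro weakly_tendsto_diff lim)
    show "U \<noteq> bot" using U by (simp add: ultrafilter_def)
    show "norm (?G ((a @ m # b) @ [n]) - ?G ((a @ m' # b) @ [n])) \<le> \<kappa>" for n
      using Suc unfolding hamming_lipschitz_def by simp
  qed
  then show ?case unfolding hamming_lipschitz_def by blast
qed

text \<open>\<open>h l d m\<close> is the increment when one variable is restored. Its bound is
  again lower semicontinuity: it is the weak limit in \<open>m'\<close> of differences between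
  values at \<open>l @ [m]\<close> and \<open>l @ [m']\<close>.\<close>

lemma iterated_weak_limit_weakly_null:
  defines "h l d m \<equiv> iterated_weak_limit U F d (l @ [m]) - iterated_weak_limit U F (Suc d) l"
  shows "weakly_tendsto (h l d) 0 U" "norm (h l d m) \<le> \<kappa>"
proof -
  let ?G = "iterated_weak_limit U F d"
  have lim: "weakly_tendsto (\<lambda>m. ?G (l @ [m])) (iterated_weak_limit U F (Suc d) l) U"
    unfolding iterated_weak_limit.simps
    by (rule weakly_tendsto_weak_limit[OF refl U
          hamming_lipschitz_bounded_last[OF hamming_lipschitz_iterated_weak_limit]])
  show "weakly_tendsto (h l d) 0 U"
    using weakly_tendsto_diff[OF lim weakly_tendsto_const] unfolding h_def by (metis diff_self)
  have "weakly_tendsto (\<lambda>m'. ?G (l @ [m]) - ?G (l @ [m'])) (h l d m) U"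
    unfolding h_def by (intro weakly_tendsto_diff weakly_tendsto_const lim)
  then show "norm (h l d m) \<le> \<kappa>"
    by (rule weakly_tendsto_norm_le)
       (use U hamming_lipschitz_iterated_weak_limit[of d] in \<open>auto simp: ultrafilter_def hamming_lipschitz_def\<close>)
qed

end

text \<open>\<open>r j\<close> is chosen recursively to extend every good list of earlier terms.
  Only \<open>p \<le> j\<close> is treated at stage \<open>j\<close>, leaving finitely many eventual
  conditions; hence the restriction to indices from \<open>p\<close> on.\<close>

lemma diagonal_sequence_of_eventual_extension:
  fixes Q :: "nat \<Rightarrow> nat list \<Rightarrow> bool" and K :: "nat \<Rightarrow> nat"
  assumes U: "U \<noteq> bot" "U \<le> sequentially"
    and base: "\<And>p. Q p []"
    and step: "\<And>p l. Q p l \<Longrightarrow> length l < K p \<Longrightarrow> eventually (\<lambda>m. Q p (l @ [m])) U"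
  obtains r :: "nat \<Rightarrow> nat" where "strict_mono r"
    "\<And>p l. sorted_wrt (<) l \<Longrightarrow> set l \<subseteq> {p..} \<Longrightarrow> length l \<le> K p \<Longrightarrow> Q p (map r l)"
proof -
  \<comment> \<open>This depends only on the values of \<open>r\<close> below \<open>j\<close>, as
    the recursive choice requires.\<close>
  let ?P = "\<lambda>r j m. (\<forall>i<j. r i < m) \<and>
    (\<forall>p\<le>j. \<forall>l. set l \<subseteq> {..<j} \<longrightarrow> length l < K p \<longrightarrow> Q p (map r l) \<longrightarrow> Q p (map r l @ [m]))"
  have "\<exists>r. \<forall>j. ?P r j (r j)"
  proof (rule dependent_wellorder_choice)
    fix m j :: nat and r s :: "nat \<Rightarrow> nat"
    assume eq: "\<And>i. i < j \<Longrightarrow> r i = s i"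
    then have map_eq: "map r l = map s l" if "set l \<subseteq> {..<j}" for l
      using that by auto
    then show "?P r j m = ?P s j m"
      using eq by (simp add: map_eq)
  next
    fix j and r :: "nat \<Rightarrow> nat"
    have "eventually (\<lambda>m. r i < m) U" for i
      using U(2) eventually_gt_at_top[of "r i"] by (rule filter_leD)
    then have "eventually (\<lambda>m. \<forall>i\<in>{..<j}. r i < m) U"
      by (intro eventually_ball_finite) auto
    moreover have "eventually (\<lambda>m. \<forall>p\<in>{..j}. \<forall>l\<in>{l. set l \<subseteq> {..<j} \<and> length l \<le> K p}.
        length l < K p \<longrightarrow> Q p (map r l) \<longrightarrow> Q p (map r l @ [m])) U"
    proof (intro eventually_ball_finite ballI finite_lists_length_le)
      fix p l
      show "eventually (\<lambda>m. length l < K p \<longrightarrow> Q p (map r l) \<longrightarrow> Q p (map r l @ [m])) U"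
        using step[of p "map r l"] by (cases "length l < K p \<and> Q p (map r l)") auto
    qed auto
    ultimately have "eventually (?P r j) U"
      by eventually_elim auto
    then show "\<exists>m. ?P r j m"
      using U(1) by (rule eventually_happens'[rotated])
  qed
  then obtain r where r: "\<And>j. ?P r j (r j)" by blast
  have "strict_mono r" using r by (intro strict_monoI) blast
  moreover have "Q p (map r l)"
    if "sorted_wrt (<) l" "set l \<subseteq> {p..}" "length l \<le> K p" for p l
    using that
  proof (induction l rule: rev_induct)
    case Nil
    then show ?case using base by simp
  next
    case (snoc j l)
    then have "Q p (map r l)" by (simp add: sorted_wrt_append)
    moreover have "p \<le> j" "set l \<subseteq> {..<j}" "length l < K p"
      using snoc.prems by (auto simp: sorted_wrt_append)
    ultimately show ?case using r[of j] by simp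
  qed
  ultimately show thesis by (rule that)
qed

text \<open>Restoring \<open>K p\<close> variables one by one costs at most
  \<open>\<kappa> / Suc p\<close> each, starting from radius \<open>B p\<close> around the total
  limit. \<open>B\<close> is fixed before \<open>K\<close>, so \<open>K p\<close> may later be
  chosen large relative to \<open>B p\<close>.\<close>

lemma aus_concentration:
  fixes F :: "nat list \<Rightarrow> 'a::real_normed_vector"
  assumes inf: "infinite_dimensional TYPE('a)" and refl: "reflexive_space TYPE('a)"
    and aus: "asymptotically_uniformly_smooth TYPE('a)"
    and \<kappa>: "0 < \<kappa>" and F: "hamming_lipschitz \<kappa> F"
  obtains B :: "nat \<Rightarrow> real" where
    "\<And>K :: nat \<Rightarrow> nat. \<exists>r u. strict_mono r \<and> (\<forall>p l. sorted_wrt (<) l \<longrightarrow> set l \<subseteq> {p..} \<longrightarrow> length l = K p \<longrightarrow>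
       norm (F (map r l) - u p) < B p + \<kappa> * real (K p) / real (Suc p))"
proof -
  obtain U :: "nat filter" where U: "ultrafilter U" "U \<le> sequentially"
    using ultrafilter_exists[of sequentially] by auto
  have "\<exists>B0>0. \<forall>B (x::'a) (h::nat \<Rightarrow> 'a). B0 \<le> B \<longrightarrow> norm x < B \<longrightarrow> weakly_tendsto h 0 U \<longrightarrow>
       (\<forall>n. norm (h n) \<le> \<kappa>) \<longrightarrow> eventually (\<lambda>n. norm (x + h n) < B + inverse (real (Suc p)) * \<kappa>) U" for p
  proof -
    have "0 < inverse (real (Suc p))" by simp
    from aus_weakly_null_growth[where ?'i = nat, OF inf aus \<kappa> this] show ?thesis by metis
  qed
  then obtain B :: "nat \<Rightarrow> real" where B: "\<And>p. 0 < B p"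
    and growth: "\<And>p b (x::'a) (h::nat \<Rightarrow> 'a). B p \<le> b \<Longrightarrow> norm x < b \<Longrightarrow> weakly_tendsto h 0 U \<Longrightarrow>
       (\<And>n. norm (h n) \<le> \<kappa>) \<Longrightarrow> eventually (\<lambda>n. norm (x + h n) < b + inverse (real (Suc p)) * \<kappa>) U"
    by metis
  show thesis
  proof (rule that)
    fix K :: "nat \<Rightarrow> nat"
    let ?G = "iterated_weak_limit U F"
    let ?u = "\<lambda>p. ?G (K p) []"
    define b where "b p l = B p + real (length l) * (inverse (real (Suc p)) * \<kappa>)" for p and l :: "nat list"
    have "0 \<le> inverse (real (Suc p)) * \<kappa>" for p using \<kappa> by simp
    then have bB: "B p \<le> b p l" for p l by (simp add: b_def)
    \<comment> \<open>Invariant after restoring the variables in \<open>l\<close>, with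
      \<open>K p - length l\<close> still removed. For \<open>l = []\<close> the distance is
      0.\<close>
    define Q where "Q p l \<longleftrightarrow> norm (?G (K p - length l) l - ?u p) < b p l" for p l
    obtain r where r: "strict_mono r"
      "\<And>p l. sorted_wrt (<) l \<Longrightarrow> set l \<subseteq> {p..} \<Longrightarrow> length l \<le> K p \<Longrightarrow> Q p (map r l)"
    proof (rule diagonal_sequence_of_eventual_extension[where U = U and Q = Q and K = K])
      show "U \<noteq> bot" using U(1) by (simp add: ultrafilter_def)
      show "Q p []" for p using B by (simp add: Q_def b_def)
      show "eventually (\<lambda>m. Q p (l @ [m])) U" if "Q p l" "length l < K p" for p l
      proof -
        define d where "d = K p - Suc (length l)"
        have d: "K p - length l = Suc d" using that(2) by (simp add: d_def)
        let ?h = "\<lambda>m. ?G d (l @ [m]) - ?G (Suc d) l"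
        have "eventually (\<lambda>m. norm ((?G (Suc d) l - ?u p) + ?h m) < b p l + inverse (real (Suc p)) * \<kappa>) U"
          using that(1) iterated_weak_limit_weakly_null[OF refl U(1) F]
          by (intro growth bB) (auto simp only: Q_def d)
        then show ?thesis
          by (rule eventually_mono) (simp add: Q_def b_def d_def algebra_simps)
      qed
    qed (use U(2) in blast)+
    have "norm (F (map r l) - ?u p) < B p + \<kappa> * real (K p) / real (Suc p)"
      if "sorted_wrt (<) l" "set l \<subseteq> {p..}" "length l = K p" for p l
      using r(2)[OF that(1,2)] that(3) by (simp add: Q_def b_def divide_inverse mult_ac)
    with r(1) show "\<exists>r u. strict_mono r \<and> (\<forall>p l. sorted_wrt (<) l \<longrightarrow> set l \<subseteq> {p..} \<longrightarrow> length l = K p \<longrightarrow>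
       norm (F (map r l) - u p) < B p + \<kappa> * real (K p) / real (Suc p))"
      by (intro exI[of _ r] exI[of _ ?u]) blast
  qed
qed

section \<open>Cesaro means\<close>

text \<open>All late blocks of length \<open>k\<close> have nearly the same average
  \<open>A\<close>, so the partial sums drift from \<open>real n *\<^sub>R A\<close> by at most
  \<open>\<epsilon> * real n\<close> plus a constant. Since \<open>A\<close> depends on
  \<open>\<epsilon>\<close>, this yields only the Cauchy property, and completeness does the
  rest.\<close>

lemma Cesaro_convergent_of_close_blocks:
  fixes z :: "nat \<Rightarrow> 'a::banach"
  assumes close: "\<And>\<epsilon>. 0 < \<epsilon> \<Longrightarrow> \<exists>k>0. \<exists>N. \<forall>a\<ge>N. \<forall>b\<ge>N.
    norm ((\<Sum>j\<in>{a..<a+k}. z j) - (\<Sum>j\<in>{b..<b+k}. z j)) \<le> \<epsilon> * real k"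
  shows "convergent (\<lambda>n. (1 / real n) *\<^sub>R (\<Sum>j\<in>{1..n}. z j))"
proof -
  define S where "S n = (\<Sum>j\<in>{1..n}. z j)" for n
  have approx: "\<exists>A D. \<forall>n>0. norm ((1 / real n) *\<^sub>R S n - A) \<le> \<epsilon> + D / real n" if \<epsilon>: "0 < \<epsilon>" for \<epsilon>
  proof -
    obtain k N where k: "0 < k" and N: "\<And>a b. a \<ge> N \<Longrightarrow> b \<ge> N \<Longrightarrow>
        norm ((\<Sum>j\<in>{a..<a+k}. z j) - (\<Sum>j\<in>{b..<b+k}. z j)) \<le> \<epsilon> * real k"
      using close[OF \<epsilon>] by blast
    define A where "A = (1 / real k) *\<^sub>R (\<Sum>j\<in>{N..<N+k}. z j)"
    \<comment> \<open>The maximum covers every start of the induction, which goes down in steps of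
      \<open>k\<close> until \<open>n \<le> N + k\<close>.\<close>
    define D where "D = Max ((\<lambda>n. norm (S n - real n *\<^sub>R A)) ` {..N+k})"
    have "norm (S n - real n *\<^sub>R A) \<le> \<epsilon> * real n + D" for n
    proof (induction n rule: less_induct)
      case (less n)
      show ?case
      proof (cases "n \<le> N + k")
        case True
        then have "norm (S n - real n *\<^sub>R A) \<le> D" unfolding D_def by (intro Max_ge) auto
        moreover have "0 \<le> \<epsilon> * real n" using \<epsilon> by simp
        ultimately show ?thesis by linarith
      next
        case False
        define m where "m = n - k"
        have m: "n = m + k" "N \<le> m" "m < n" using False k by (auto simp: m_def)
        have "{1..n} = {1..m} \<union> {Suc m..<Suc m + k}" using m by auto
        then have "S n = S m + (\<Sum>j\<in>{Suc m..<Suc m + k}. z j)"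
          unfolding S_def by (simp only:, intro sum.union_disjoint) auto
        then have eq: "S n - real n *\<^sub>R A = (S m - real m *\<^sub>R A) +
            ((\<Sum>j\<in>{Suc m..<Suc m + k}. z j) - (\<Sum>j\<in>{N..<N+k}. z j))"
          using k by (simp add: m(1) A_def algebra_simps)
        have "norm (S n - real n *\<^sub>R A) \<le> (\<epsilon> * real m + D) + \<epsilon> * real k"
          unfolding eq using less.IH[OF m(3)] N[of "Suc m" N] m(2)
          by (intro norm_triangle_mono) auto
        then show ?thesis by (simp add: m(1) algebra_simps)
      qed
    qed
    then have "norm ((1 / real n) *\<^sub>R S n - A) \<le> \<epsilon> + D / real n" if "0 < n" for n
    proof -
      have "(1 / real n) *\<^sub>R S n - A = (1 / real n) *\<^sub>R (S n - real n *\<^sub>R A)"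
        using that by (simp add: algebra_simps)
      then have "norm ((1 / real n) *\<^sub>R S n - A) = norm (S n - real n *\<^sub>R A) / real n"
        by simp
      also have "\<dots> \<le> (\<epsilon> * real n + D) / real n"
        by (intro divide_right_mono \<open>\<And>n. norm (S n - real n *\<^sub>R A) \<le> \<epsilon> * real n + D\<close>) simp
      also have "\<dots> = \<epsilon> + D / real n" using that by (simp add: add_divide_distrib)
      finally show ?thesis .
    qed
    then show ?thesis by blast
  qed
  have "Cauchy (\<lambda>n. (1 / real n) *\<^sub>R S n)"
  proof (rule CauchyI')
    fix e :: real assume e: "0 < e"
    obtain A D where AD: "\<And>n. 0 < n \<Longrightarrow> norm ((1 / real n) *\<^sub>R S n - A) \<le> e / 4 + D / real n"
      using approx[of "e / 4"] e by auto
    have "(\<lambda>n. D / real n) \<longlonglongrightarrow> 0" by (rule lim_const_over_n)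
    then have "eventually (\<lambda>n. D / real n < e / 4) sequentially"
      using e by (intro order_tendstoD(2)) auto
    then obtain M where M: "\<And>n. n \<ge> M \<Longrightarrow> D / real n < e / 4"
      by (auto simp: eventually_sequentially)
    \<comment> \<open>\<open>Suc M\<close> keeps \<open>n\<close> positive, away from division by
      zero.\<close>
    have close: "dist ((1 / real n) *\<^sub>R S n) A < e / 2" if "n \<ge> Suc M" for n
      using AD[of n] M[of n] that unfolding dist_norm by linarith
    show "\<exists>M. \<forall>m\<ge>M. \<forall>n>m. dist ((1 / real m) *\<^sub>R S m) ((1 / real n) *\<^sub>R S n) < e"
      using close by (intro exI[of _ "Suc M"]) (metis dist_triangle_half_l less_imp_le order_trans)
  qed
  then show ?thesis
    unfolding S_def by (rule Cauchy_convergent)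
qed

section \<open>From concentration to the Banach-Saks property\<close>

theorem theorem1p1:
  fixes f :: "'x::banach \<Rightarrow> 'y::banach"
  assumes "infinite_dimensional TYPE('x)"
    and "infinite_dimensional TYPE('y)"
    and "reflexive_space TYPE('y)"
    and "asymptotically_uniformly_smooth TYPE('y)"
    and "coarse_lipschitz_embedding f"
  shows "banach_saks TYPE('x)"
  unfolding banach_saks_def
proof (intro allI impI)
  fix x :: "nat \<Rightarrow> 'x" assume "bounded (range x)"
  then obtain C where C: "0 < C" "\<And>n. norm (x n) \<le> C"
    by (auto simp: bounded_pos)
  obtain L where L: "0 < L" and up: "\<And>a b. dist (f a) (f b) \<le> L * dist a b + L"
    and low: "\<And>a b. dist a b / L - L \<le> dist (f a) (f b)"
    using assms(5) unfolding coarse_lipschitz_embedding_def by blast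
  define F where "F l = f (sum_list (map x l))" for l
  \<comment> \<open>Exchanging one index moves the sum by at most \<open>2 * C\<close>, whatever the
    length of the list.\<close>
  define \<kappa> where "\<kappa> = L * (2 * C) + L"
  have \<kappa>: "0 < \<kappa>" using L C(1) by (simp add: \<kappa>_def add_pos_pos)
  have "hamming_lipschitz \<kappa> F"
    unfolding hamming_lipschitz_def
  proof (intro allI)
    fix a b :: "nat list" and m m'
    have "norm (F (a @ m # b) - F (a @ m' # b)) \<le> L * dist (x m) (x m') + L"
      using up[of "sum_list (map x (a @ m # b))" "sum_list (map x (a @ m' # b))"]
      by (simp add: F_def dist_norm)
    also have "dist (x m) (x m') \<le> 2 * C"
      using C(2)[of m] C(2)[of m'] norm_triangle_ineq4[of "x m" "x m'"] by (simp add: dist_norm)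
    finally show "norm (F (a @ m # b) - F (a @ m' # b)) \<le> \<kappa>"
      using L by (simp add: \<kappa>_def)
  qed
  from aus_concentration[OF assms(2-4) \<kappa> this] obtain B :: "nat \<Rightarrow> real" where B:
    "\<And>K :: nat \<Rightarrow> nat. \<exists>r u. strict_mono r \<and> (\<forall>p l. sorted_wrt (<) l \<longrightarrow> set l \<subseteq> {p..} \<longrightarrow> length l = K p \<longrightarrow>
       norm (F (map r l) - u p) < B p + \<kappa> * real (K p) / real (Suc p))"
    by metis
  \<comment> \<open>The block length is chosen to make the error terms not proportional to it,
    \<open>L * (2 * B p + L)\<close>, at most \<open>real k / real (Suc p)\<close>.\<close>
  have "\<exists>k>0. L * (2 * B p + L) * real (Suc p) \<le> real k" for p
  proof -
    obtain k :: nat where "max 1 (L * (2 * B p + L) * real (Suc p)) \<le> real k"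
      using real_arch_simple by blast
    then show ?thesis by (intro exI[of _ k]) auto
  qed
  then obtain K :: "nat \<Rightarrow> nat" where K: "\<And>p. 0 < K p" "\<And>p. L * (2 * B p + L) * real (Suc p) \<le> real (K p)"
    by metis
  obtain r u where r: "strict_mono r" and conc: "\<And>p l. sorted_wrt (<) l \<Longrightarrow> set l \<subseteq> {p..} \<Longrightarrow> length l = K p \<Longrightarrow>
       norm (F (map r l) - u p) < B p + \<kappa> * real (K p) / real (Suc p)"
    using B[of K] by blast
  have "convergent (\<lambda>n. (1 / real n) *\<^sub>R (\<Sum>j\<in>{1..n}. x (r j)))"
  proof (rule Cesaro_convergent_of_close_blocks)
    fix \<epsilon> :: real assume \<epsilon>: "0 < \<epsilon>"
    \<comment> \<open>The final error per term is
      \<open>(1 + 2 * L * \<kappa>) / real (Suc p)\<close>, which this \<open>p\<close> brings below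
      \<open>\<epsilon>\<close>.\<close>
    obtain p where p: "(1 + 2 * L * \<kappa>) / \<epsilon> < real p" using reals_Archimedean2 by blast
    then have p': "(1 + 2 * L * \<kappa>) / real (Suc p) \<le> \<epsilon>"
      using \<epsilon> by (simp add: field_simps)
    let ?s = "\<lambda>a. \<Sum>j\<in>{a..<a + K p}. x (r j)"
    define R where "R = B p + \<kappa> * real (K p) / real (Suc p)"
    have near: "dist (f (?s a)) (u p) < R" if "p \<le> a" for a
    proof -
      have "F (map r [a..<a + K p]) = f (?s a)"
        by (simp add: F_def comp_def interv_sum_list_conv_sum_set_nat)
      moreover have "set [a..<a + K p] \<subseteq> {p..}" using that by auto
      ultimately show ?thesis
        using conc[of "[a..<a + K p]" p] by (simp add: dist_norm R_def)
    qed
    have "norm (?s a - ?s b) \<le> \<epsilon> * real (K p)" if "p \<le> a" "p \<le> b" for a b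
    proof -
      \<comment> \<open>Both images lie within \<open>R\<close> of \<open>u p\<close>, and the lower
        coarse Lipschitz estimate carries this back to the sums.\<close>
      have "dist (?s a) (?s b) / L - L \<le> 2 * R"
        using low[of "?s a" "?s b"] near[OF that(1)] near[OF that(2)]
          dist_triangle2[of "f (?s a)" "f (?s b)" "u p"] by linarith
      then have "dist (?s a) (?s b) / L \<le> 2 * B p + L + 2 * \<kappa> * real (K p) / real (Suc p)"
        by (simp add: R_def)
      then have "dist (?s a) (?s b) \<le> L * (2 * B p + L + 2 * \<kappa> * real (K p) / real (Suc p))"
        using L by (simp only: pos_divide_le_eq mult.commute)
      also have "\<dots> = L * (2 * B p + L) + 2 * L * \<kappa> * real (K p) / real (Suc p)"
        by (simp add: algebra_simps)
      also have "\<dots> \<le> real (K p) / real (Suc p) + 2 * L * \<kappa> * real (K p) / real (Suc p)"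
        using K(2)[of p] by (intro add_right_mono) (simp only: pos_le_divide_eq of_nat_0_less_iff zero_less_Suc)
      also have "\<dots> = (1 + 2 * L * \<kappa>) / real (Suc p) * real (K p)"
        by (simp add: add_divide_distrib algebra_simps)
      also have "\<dots> \<le> \<epsilon> * real (K p)"
        using p' by (intro mult_right_mono) auto
      finally show ?thesis by (simp add: dist_norm)
    qed
    then show "\<exists>k>0. \<exists>N. \<forall>a\<ge>N. \<forall>b\<ge>N. norm ((\<Sum>j\<in>{a..<a+k}. x (r j)) - (\<Sum>j\<in>{b..<b+k}. x (r j))) \<le> \<epsilon> * real k"
      using K(1)[of p] by blast
  qed
  with r show "\<exists>r. strict_mono r \<and> convergent (\<lambda>k. (1 / real k) *\<^sub>R (\<Sum>j\<in>{1..k}. x (r j)))"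
    by blast
qed

end
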